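(* Let $n\ge 2$ be an integer. The number $\Psi(n)$ of polyfunctions over $\mathbb{Z}_n$ is given by $$\Psi(n)=\prod_{k=1}^{t(n)}\gcd(n,\beta_k!)^{\beta_k-\beta_{k-1}},$$ with the convention $\beta_0:=0$.
   Context: $\mathbb{Z}_n=\mathbb{Z}/n\mathbb{Z}$. A polyfunction over $\mathbb{Z}_n$ is a function $f:\mathbb{Z}_n\to\mathbb{Z}_n$ for which there is a polynomial $p\in\mathbb{Z}_n[x]$ with $f(x)=p(x)$ for all $x\in\mathbb{Z}_n$. For a positive integer $k$ let $s(k):=\min\{j\in\mathbb{N}: k\mid j!\}$ (Smarandache function). For $n\ge 2$ let $q(n)$ be the smallest prime divisor of $n$, and consider the finite set $$\{s(\gcd(n,\alpha!)) : \alpha\in\mathbb{N},\ s(\gcd(n,\alpha!))\ge q(n)\}.$$ Let $t(n)$ be its cardinality and write its elements in descending order as $s(n)=\beta_1>\beta_2>\dots>\beta_{t(n)}=q(n)$. *)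

theory Defs
  imports "HOL-Number_Theory.Residues" "HOL-Algebra.Polynomials"
begin

text \<open>
  Functions on a ring are taken extensionally on the carrier, so that distinct elements of
  \<open>polyfunctions R\<close> differ at some point of \<open>carrier R\<close>. The polynomials are those with
  coefficients in the whole carrier.
\<close>

definition polyfunctions :: "('a, 'b) ring_scheme \<Rightarrow> ('a \<Rightarrow> 'a) set" where
  "polyfunctions R =
    {f \<in> carrier R \<rightarrow>\<^sub>E carrier R.
      \<exists>p \<in> carrier (univ_poly R (carrier R)). \<forall>x \<in> carrier R. f x = ring.eval R p x}"

definition num_polyfunctions :: "nat \<Rightarrow> nat" where
  "num_polyfunctions n = card (polyfunctions (residue_ring (int n)))"

definition smarandache :: "nat \<Rightarrow> nat" where
  "smarandache k = (LEAST j. k dvd fact j)"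

definition least_prime_divisor :: "nat \<Rightarrow> nat" where
  "least_prime_divisor n = (LEAST p. Factorial_Ring.prime p \<and> p dvd n)"

definition beta_set :: "nat \<Rightarrow> nat set" where
  "beta_set n =
    {smarandache (gcd n (fact a)) | a. smarandache (gcd n (fact a)) \<ge> least_prime_divisor n}"

text \<open>\<open>sorted_list_of_set\<close> is only meaningful on finite sets.\<close>

lemma finite_beta_set:
  assumes "n > 0"
  shows "finite (beta_set n)"
proof -
  have "beta_set n \<subseteq> smarandache ` {d. d dvd n}"
    by (auto simp: beta_set_def)
  moreover have "finite {d. d dvd n}"
    using assms by (rule finite_divisors_nat)
  ultimately show ?thesis
    by (meson finite_imageI finite_subset)
qed

definition beta_count :: "nat \<Rightarrow> nat" where
  "beta_count n = card (beta_set n)"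

text \<open>
  For \<open>1 \<le> k \<le> beta_count n\<close>, \<open>beta n k\<close> is the \<open>k\<close>-th largest element of \<open>beta_set n\<close>.
\<close>

definition beta :: "nat \<Rightarrow> nat \<Rightarrow> nat" where
  "beta n k = (if k = 0 then 0 else rev (sorted_list_of_set (beta_set n)) ! (k - 1))"

end

theory Submission imports Defs "HOL-Computational_Algebra.Polynomial"
begin

text \<open>
  Over the integers, the falling factorials $(x)_k = x(x-1)\cdots(x-k+1)$ are monic of degree
  \<open>k\<close>, so every integer polynomial is an integer combination of them. Modulo \<open>n\<close> this gives a
  normal form for polyfunctions, for two reasons. First, $(x)_k = k! \binom{x}{k}$ takes only
  multiples of \<open>k!\<close> as values, so changing the coefficient $c_k$ by a multiple of
  $n / \gcd(n, k!)$ does not change the function modulo \<open>n\<close>; in particular, the terms with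
  $n \mid k!$ can be dropped, and all coefficients can be taken in the range
  $0 \le c_k < n / \gcd(n, k!)$ with $k < s(n)$. Second, such coefficients are determined by the
  values at $0, 1, \dots, s(n) - 1$, because $(m)_k = 0$ for $k > m$ and $(m)_m = m!$, so that the
  system of congruences is triangular. Hence
  \[ \Psi(n) = \prod_{k < s(n)} \frac{n}{\gcd(n, k!)}, \]
  which is \<open>num_polyfunctions_eq_prod\<close>.

  The function $k \mapsto \gcd(n, k!)$ is a step function: it is \<open>1\<close> below the smallest prime
  divisor of \<open>n\<close>, and from there on it is constant between two consecutive elements of
  \<open>beta_set n\<close> (\<open>gcd_fact_between\<close>). Collecting equal factors, the interval
  $[\beta_{k+1}, \beta_k)$ contributes
  $\gcd(n, \beta_{k+1}!)^{\beta_k - \beta_{k+1}}$ to the denominator, while the numerator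
  $n^{s(n)}$ is the factor with index \<open>1\<close>, because $\gcd(n, \beta_1!) = n$ and
  $\beta_1 - \beta_0 = s(n)$. This is \<open>beta_product\<close>.
\<close>

section \<open>Integer polynomials in the falling factorial basis\<close>

text \<open>
  This is \<open>fact k * (x gchoose k)\<close>; the product form makes it visible that it is an integer
  polynomial in \<open>x\<close>.
\<close>

definition falling_factorial :: "int \<Rightarrow> nat \<Rightarrow> int" where
  "falling_factorial x k = (\<Prod>i=0..<k. x - int i)"

lemma falling_factorial_0 [simp]: "falling_factorial x 0 = 1"
  by (simp add: falling_factorial_def)

lemma fact_dvd_falling_factorial: "fact k dvd falling_factorial x k"
  unfolding falling_factorial_def gbinomial_int_mult_fact [symmetric] by simp

lemma falling_factorial_self: "falling_factorial (int m) m = fact m"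
  unfolding falling_factorial_def gbinomial_int_mult_fact [symmetric] by simp

lemma falling_factorial_eq_0: "m < k \<Longrightarrow> falling_factorial (int m) k = 0"
  by (auto simp: falling_factorial_def)

lemma mult_falling_factorial:
  "x * falling_factorial x k = falling_factorial x (Suc k) + int k * falling_factorial x k"
  by (simp add: falling_factorial_def algebra_simps)

definition falling_sum :: "nat \<Rightarrow> (nat \<Rightarrow> int) \<Rightarrow> int \<Rightarrow> int" where
  "falling_sum N c x = (\<Sum>k<N. c k * falling_factorial x k)"

text \<open>
  By Horner's scheme it suffices that multiplication by \<open>x\<close> preserves integer combinations of
  falling factorials, which is the recurrence \<open>mult_falling_factorial\<close>.
\<close>

lemma poly_eq_falling_sum: "\<exists>N c. \<forall>x. poly q x = falling_sum N c x"
proof (induction q)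
  case 0
  show ?case by (rule exI[of _ 0]) (simp add: falling_sum_def)
next
  case (pCons a q)
  then obtain N c where q: "\<And>x. poly q x = falling_sum N c x" by auto
  \<comment> \<open>Each old term feeds two new ones: index \<open>k\<close> into \<open>Suc k\<close>, and \<open>k\<close> times itself into \<open>k\<close>.\<close>
  define c' where "c' k = (case k of 0 \<Rightarrow> a | Suc j \<Rightarrow> c j) + (if k < N then int k * c k else 0)" for k
  have "poly (pCons a q) x = falling_sum (Suc N) c' x" for x
  proof -
    let ?F = "\<lambda>k. falling_factorial x k"
    have "poly (pCons a q) x = a + (\<Sum>k<N. c k * (x * ?F k))"
      by (simp add: q falling_sum_def sum_distrib_left mult.left_commute)
    also have "\<dots> = a + (\<Sum>k<N. c k * ?F (Suc k)) + (\<Sum>k<N. int k * c k * ?F k)"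
      unfolding mult_falling_factorial
      by (simp add: sum.distrib algebra_simps)
    also have "a + (\<Sum>k<N. c k * ?F (Suc k)) =
        (\<Sum>k<Suc N. (case k of 0 \<Rightarrow> a | Suc j \<Rightarrow> c j) * ?F k)"
      by (subst sum.lessThan_Suc_shift) simp
    also have "(\<Sum>k<N. int k * c k * ?F k) =
        (\<Sum>k<Suc N. (if k < N then int k * c k else 0) * ?F k)"
      by simp
    finally show ?thesis
      by (simp add: falling_sum_def c'_def algebra_simps sum.distrib del: sum.lessThan_Suc)
  qed
  thus ?case by blast
qed

lemma falling_sum_eq_poly: "\<exists>q. \<forall>x. poly q x = falling_sum N c x"
proof (rule exI, rule allI)
  fix x
  show "poly (\<Sum>k<N. smult (c k) (\<Prod>i=0..<k. [:- int i, 1:])) x = falling_sum N c x"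
    by (simp add: falling_sum_def falling_factorial_def poly_sum poly_prod)
qed

section \<open>Normal form modulo \<open>n\<close>\<close>

text \<open>
  Applied with \<open>m = fact k\<close>, this says which changes of the \<open>k\<close>-th coefficient are invisible
  modulo \<open>n\<close>.
\<close>

lemma dvd_mult_iff_div_gcd_dvd:
  fixes n e m :: int
  assumes "n \<noteq> 0"
  shows "n dvd e * m \<longleftrightarrow> n div gcd n m dvd e"
proof -
  define g where "g = gcd n m"
  have g: "g \<noteq> 0" using assms by (simp add: g_def)
  obtain a b where ab: "n = g * a" "m = g * b"
    unfolding g_def by (meson dvd_def gcd_dvd1 gcd_dvd2)
  have "coprime (n div g) (m div g)"
    using assms unfolding g_def by (intro div_gcd_coprime) auto
  hence "coprime a b" using ab g by simp
  hence "n dvd e * m \<longleftrightarrow> a dvd e"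
    using ab g by (simp add: mult.left_commute coprime_dvd_mult_left_iff)
  moreover have "n div g = a" using ab g by simp
  ultimately show ?thesis by (simp add: g_def)
qed

text \<open>
  Existence of the normal form: each \<open>c k\<close> is replaced by its remainder. Since \<open>k!\<close> divides
  $(x)_k$, the values change only by multiples of \<open>n\<close>; the same reason removes the
  terms from \<open>M\<close> on.
\<close>

lemma falling_sum_reduce_cong:
  assumes "n > 0" and M: "n dvd fact M"
  shows "\<exists>d \<in> (\<Pi>\<^sub>E k \<in> {..<M}. {0..<int n div gcd (int n) (fact k)}).
           \<forall>x. [falling_sum N c x = falling_sum M d x] (mod int n)"
proof -
  let ?r = "\<lambda>k. int n div gcd (int n) (fact k)"
  have r: "?r k > 0" for k
  proof -
    have "gcd (int n) (fact k) > 0" "gcd (int n) (fact k) \<le> int n"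
      using assms(1) by (auto intro: gcd_le1_int)
    thus ?thesis by (simp add: pos_imp_zdiv_pos_iff)
  qed
  \<comment> \<open>Padding both coefficient sequences by zeros allows a termwise comparison.\<close>
  define c0 where "c0 k = (if k < N then c k else 0)" for k
  define d where "d = (\<lambda>k\<in>{..<M}. c0 k mod ?r k)"
  have "[falling_sum N c x = falling_sum M d x] (mod int n)" for x
  proof -
    let ?F = "\<lambda>k. falling_factorial x k"
    let ?L = "max N M"
    define d0 where "d0 k = (if k < M then d k else 0)" for k
    have "falling_sum N c x = (\<Sum>k<?L. c0 k * ?F k)"
      unfolding falling_sum_def by (rule sum.mono_neutral_cong_left) (auto simp: c0_def)
    moreover have "falling_sum M d x = (\<Sum>k<?L. d0 k * ?F k)"
      unfolding falling_sum_def by (rule sum.mono_neutral_cong_left) (auto simp: d0_def)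
    moreover have "[c0 k * ?F k = d0 k * ?F k] (mod int n)" for k
    proof -
      have "int n dvd (c0 k - d0 k) * fact k"
      proof (cases "k < M")
        case True
        hence "?r k dvd c0 k - d0 k" by (simp add: d0_def d_def)
        thus ?thesis using assms(1) by (simp add: dvd_mult_iff_div_gcd_dvd)
      next
        case False
        hence "n dvd fact k" using M by (meson dvd_trans fact_dvd not_less)
        hence "int n dvd fact k" by (metis of_nat_dvd_iff of_nat_fact)
        thus ?thesis by simp
      qed
      also have "(c0 k - d0 k) * fact k dvd (c0 k - d0 k) * ?F k"
        by (intro mult_dvd_mono fact_dvd_falling_factorial dvd_refl)
      finally have "int n dvd c0 k * ?F k - d0 k * ?F k"
        by (simp only: left_diff_distrib)
      thus ?thesis by (simp add: cong_iff_dvd_diff)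
    qed
    ultimately show ?thesis by (simp add: cong_sum)
  qed
  moreover have "d \<in> (\<Pi>\<^sub>E k \<in> {..<M}. {0..<?r k})"
    using r by (auto simp: d_def)
  ultimately show ?thesis by blast
qed

text \<open>
  Uniqueness of the normal form. At \<open>x = m\<close> the terms above \<open>m\<close> vanish and those below agree by
  induction, which leaves $n \mid (c_m - d_m)\, m!$.
\<close>

lemma falling_sum_cong_imp_coeff_eq:
  assumes "n > 0"
    and c: "c \<in> (\<Pi>\<^sub>E k \<in> {..<M}. {0..<int n div gcd (int n) (fact k)})"
    and d: "d \<in> (\<Pi>\<^sub>E k \<in> {..<M}. {0..<int n div gcd (int n) (fact k)})"
    and eq: "\<And>m. m < M \<Longrightarrow> [falling_sum M c (int m) = falling_sum M d (int m)] (mod int n)"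
  shows "c = d"
proof (rule PiE_ext[OF c d])
  fix m assume "m \<in> {..<M}"
  thus "c m = d m"
  proof (induction m rule: less_induct)
    case (less m)
    let ?F = "\<lambda>k. falling_factorial (int m) k"
    have eval: "falling_sum M e (int m) = (\<Sum>k<m. e k * ?F k) + e m * fact m" for e
    proof -
      have "falling_sum M e (int m) = (\<Sum>k<Suc m. e k * ?F k)"
        unfolding falling_sum_def using less.prems falling_factorial_eq_0
        by (intro sum.mono_neutral_right) auto
      thus ?thesis by (simp add: falling_factorial_self)
    qed
    have "(\<Sum>k<m. c k * ?F k) = (\<Sum>k<m. d k * ?F k)"
      using less by (intro sum.cong) auto
    hence "int n dvd (c m - d m) * fact m"
      using eq[of m] less.prems by (simp add: eval cong_iff_dvd_diff algebra_simps)
    hence "c m mod (int n div gcd (int n) (fact m)) = d m mod (int n div gcd (int n) (fact m))"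
      using assms(1) by (simp add: dvd_mult_iff_div_gcd_dvd mod_eq_dvd_iff)
    thus ?case
      using PiE_mem[OF c less.prems] PiE_mem[OF d less.prems] by simp
  qed
qed

section \<open>Counting polyfunctions\<close>

text \<open>
  The two polynomial libraries order coefficients oppositely: the leading coefficient is the head
  of the list in \<open>univ_poly\<close>, and the last entry of the list given to \<open>Poly\<close>.
\<close>

lemma (in residues) eval_eq_poly_mod:
  assumes "set p \<subseteq> carrier R" "x \<in> carrier R"
  shows "eval p x = poly (Poly (rev p)) x mod m"
  using assms
proof (induction p rule: rev_induct)
  case Nil
  show ?case by (simp add: res_zero_eq)
next
  case (snoc b p)
  hence "eval (p @ [b]) x = ((eval p x) \<otimes> x) \<oplus> b"
    by (intro eval_append_aux) auto
  with snoc show ?case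
    by (simp add: res_mult_eq res_add_eq mod_simps algebra_simps)
qed

lemma poly_Poly_map_mod:
  "poly (Poly (map (\<lambda>a. a mod m) as)) x mod m = poly (Poly as) x mod (m :: int)"
proof (induction as)
  case (Cons a as)
  hence "[a mod m + x * poly (Poly (map (\<lambda>a. a mod m) as)) x = a + x * poly (Poly as) x] (mod m)"
    by (intro cong_add cong_mult cong_refl) (simp_all add: cong_def)
  thus ?case by (simp add: cong_def)
qed simp

text \<open>
  A polynomial over the residue ring lifts to the integers, and an integer polynomial can be reduced
  coefficientwise. The reduction may kill leading coefficients, hence the normalization of the
  coefficient list.
\<close>

lemma (in residues) polyfunctions_eq_int_polys:
  "polyfunctions R = (\<lambda>q. \<lambda>x\<in>carrier R. poly q x mod m) ` UNIV"
proof (intro equalityI subsetI)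
  fix f assume "f \<in> polyfunctions R"
  then obtain p where f: "f \<in> carrier R \<rightarrow>\<^sub>E carrier R"
    and p: "p \<in> carrier (univ_poly R (carrier R))" and fp: "\<forall>x\<in>carrier R. f x = eval p x"
    unfolding polyfunctions_def by blast
  have "set p \<subseteq> carrier R"
    using p polynomial_incl unfolding univ_poly_def by auto
  hence "f = (\<lambda>x\<in>carrier R. poly (Poly (rev p)) x mod m)"
    using f fp eval_eq_poly_mod by (intro extensionalityI[of _ "carrier R"]) (auto simp: PiE_def)
  thus "f \<in> (\<lambda>q. \<lambda>x\<in>carrier R. poly q x mod m) ` UNIV" by blast
next
  fix f assume "f \<in> (\<lambda>q. \<lambda>x\<in>carrier R. poly q x mod m) ` UNIV"
  then obtain q where f: "f = (\<lambda>x\<in>carrier R. poly q x mod m)" by blast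
  define l where "l = rev (map (\<lambda>a. a mod m) (coeffs q))"
  have l: "set l \<subseteq> carrier R"
    using m_gt_one by (auto simp: l_def res_carrier_eq)
  have "normalize l \<in> carrier (univ_poly R (carrier R))"
    using normalize_gives_polynomial[OF l] by (simp add: univ_poly_def)
  moreover have "f x = eval (normalize l) x" if "x \<in> carrier R" for x
    using that l by (simp add: f eval_normalize eval_eq_poly_mod l_def poly_Poly_map_mod)
  moreover have "f \<in> carrier R \<rightarrow>\<^sub>E carrier R"
    using m_gt_one by (auto simp: f res_carrier_eq)
  ultimately show "f \<in> polyfunctions R"
    unfolding polyfunctions_def by blast
qed

text \<open>
  The bound \<open>M \<le> n\<close> makes the points \<open>0, \<dots>, M - 1\<close>, at which the coefficients are recovered,
  distinct elements of the ring.
\<close>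

theorem num_polyfunctions_eq_prod:
  assumes "n \<ge> 2" "n dvd fact M" "M \<le> n"
  shows "num_polyfunctions n = (\<Prod>k<M. n div gcd n (fact k))"
proof -
  interpret residues "int n" "residue_ring (int n)"
    using assms by unfold_locales auto
  let ?R = "residue_ring (int n)"
  define C where "C = (\<Pi>\<^sub>E k \<in> {..<M}. {0..<int n div gcd (int n) (fact k)})"
  define \<Phi> where "\<Phi> c = (\<lambda>x\<in>carrier ?R. falling_sum M c x mod int n)" for c
  have "polyfunctions ?R = \<Phi> ` C"
  proof (intro equalityI subsetI)
    fix f assume "f \<in> polyfunctions ?R"
    then obtain q where f: "f = (\<lambda>x\<in>carrier ?R. poly q x mod int n)"
      by (auto simp: polyfunctions_eq_int_polys)
    obtain N c where "\<And>x. poly q x = falling_sum N c x"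
      using poly_eq_falling_sum by blast
    moreover obtain d where "d \<in> C" "\<And>x. [falling_sum N c x = falling_sum M d x] (mod int n)"
      using falling_sum_reduce_cong[of n M N c] assms unfolding C_def by auto
    ultimately show "f \<in> \<Phi> ` C"
      by (auto simp: f \<Phi>_def cong_def)
  next
    fix f assume "f \<in> \<Phi> ` C"
    then obtain c where "f = \<Phi> c" by blast
    thus "f \<in> polyfunctions ?R"
    proof -
      obtain q where "\<And>x. poly q x = falling_sum M c x"
        using falling_sum_eq_poly by blast
      hence "f = (\<lambda>x\<in>carrier ?R. poly q x mod int n)"
        by (simp add: \<open>f = \<Phi> c\<close> \<Phi>_def)
      thus ?thesis unfolding polyfunctions_eq_int_polys by (rule image_eqI) simp
    qed
  qed
  moreover have "inj_on \<Phi> C"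
  proof (rule inj_onI)
    fix c d assume cd: "c \<in> C" "d \<in> C" "\<Phi> c = \<Phi> d"
    have "[falling_sum M c (int m) = falling_sum M d (int m)] (mod int n)" if "m < M" for m
    proof -
      have "int m \<in> carrier ?R" using that assms by (simp add: res_carrier_eq)
      thus ?thesis using fun_cong[OF cd(3), of "int m"] by (simp add: \<Phi>_def cong_def)
    qed
    thus "c = d"
      using falling_sum_cong_imp_coeff_eq[of n c M d] cd assms unfolding C_def by auto
  qed
  ultimately have "num_polyfunctions n = card C"
    by (simp add: num_polyfunctions_def card_image)
  also have "\<dots> = (\<Prod>k<M. nat (int n div gcd (int n) (fact k)))"
    by (simp add: C_def card_PiE)
  also have "\<dots> = (\<Prod>k<M. n div gcd n (fact k))"
  proof (rule prod.cong[OF refl])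
    fix k
    have "gcd (int n) (fact k) = int (gcd n (fact k))"
      by (metis gcd_int_int_eq of_nat_fact)
    thus "nat (int n div gcd (int n) (fact k)) = n div gcd n (fact k)"
      by (simp only: zdiv_int [symmetric] nat_int)
  qed
  finally show ?thesis .
qed

section \<open>The step function \<open>k \<mapsto> gcd n (fact k)\<close>\<close>

lemma smarandache_dvd: "k > 0 \<Longrightarrow> k dvd fact (smarandache k)"
  unfolding smarandache_def by (rule LeastI[of _ k]) (simp add: dvd_fact)

lemma smarandache_le: "k dvd fact j \<Longrightarrow> smarandache k \<le> j"
  unfolding smarandache_def by (rule Least_le)

context
  fixes n :: nat
  assumes n: "n \<ge> 2"
begin

lemma least_prime_divisor_prime: "Factorial_Ring.prime (least_prime_divisor n)"
  and least_prime_divisor_dvd: "least_prime_divisor n dvd n"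
proof -
  have "\<exists>p. Factorial_Ring.prime p \<and> p dvd n"
    using n by (intro prime_factor_nat) auto
  hence "Factorial_Ring.prime (least_prime_divisor n) \<and> least_prime_divisor n dvd n"
    unfolding least_prime_divisor_def by (rule LeastI_ex)
  thus "Factorial_Ring.prime (least_prime_divisor n)" "least_prime_divisor n dvd n" by auto
qed

lemma least_prime_divisor_le: "Factorial_Ring.prime p \<Longrightarrow> p dvd n \<Longrightarrow> least_prime_divisor n \<le> p"
  unfolding least_prime_divisor_def by (rule Least_le) simp

lemma gcd_fact_smarandache: "gcd n (fact (smarandache (gcd n (fact j)))) = gcd n (fact j)"
proof (rule dvd_antisym)
  let ?g = "gcd n (fact j)"
  have g: "?g > 0" using n by simp
  thus "?g dvd gcd n (fact (smarandache ?g))"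
    using smarandache_dvd by (intro gcd_greatest) auto
  have "smarandache ?g \<le> j" by (rule smarandache_le) simp
  thus "gcd n (fact (smarandache ?g)) dvd ?g"
    by (intro gcd_greatest) (auto intro: dvd_trans fact_dvd)
qed

lemma gcd_fact_eq_1:
  assumes "j < least_prime_divisor n"
  shows "gcd n (fact j) = 1"
proof (rule ccontr)
  assume "gcd n (fact j) \<noteq> 1"
  then obtain p where p: "Factorial_Ring.prime p" "p dvd gcd n (fact j)"
    using prime_factor_nat by blast
  hence "p \<le> j" "least_prime_divisor n \<le> p"
    by (auto simp: prime_dvd_fact_iff intro: least_prime_divisor_le)
  thus False using assms by simp
qed

lemma smarandache_gcd_fact_mem_beta_set:
  assumes "j \<ge> least_prime_divisor n"
  shows "smarandache (gcd n (fact j)) \<in> beta_set n"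
proof -
  let ?q = "least_prime_divisor n"
  have "?q dvd fact j"
    using assms least_prime_divisor_prime by (simp add: prime_dvd_fact_iff)
  hence "?q dvd gcd n (fact j)"
    using least_prime_divisor_dvd by (rule gcd_greatest[rotated])
  also have "\<dots> dvd fact (smarandache (gcd n (fact j)))"
    using n by (intro smarandache_dvd) simp
  finally have "?q dvd fact (smarandache (gcd n (fact j)))" .
  hence "?q \<le> smarandache (gcd n (fact j))"
    using least_prime_divisor_prime by (simp add: prime_dvd_fact_iff)
  thus ?thesis unfolding beta_set_def by blast
qed

text \<open>
  Going down from \<open>j\<close>, the gcd first drops below \<open>smarandache (gcd n (fact j))\<close>. That number
  lies in \<open>beta_set n\<close>, so the gcd is constant as long as no element of \<open>beta_set n\<close> is passed.
\<close>

lemma gcd_fact_between: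
  assumes "least_prime_divisor n \<le> j" "b \<le> j"
    and gap: "\<And>b'. b' \<in> beta_set n \<Longrightarrow> b' \<le> j \<Longrightarrow> b' \<le> b"
  shows "gcd n (fact j) = gcd n (fact b)"
proof (rule dvd_antisym)
  let ?s = "smarandache (gcd n (fact j))"
  have "?s \<le> j" by (rule smarandache_le) simp
  hence "?s \<le> b" using gap smarandache_gcd_fact_mem_beta_set assms(1) by blast
  hence "gcd n (fact ?s) dvd gcd n (fact b)"
    by (intro gcd_mono fact_dvd) auto
  thus "gcd n (fact j) dvd gcd n (fact b)" by (simp add: gcd_fact_smarandache)
  show "gcd n (fact b) dvd gcd n (fact j)"
    using assms(2) by (intro gcd_mono fact_dvd) auto
qed

lemma Max_beta_set: "Max (beta_set n) = smarandache n"
proof (rule Max_eqI)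
  show "finite (beta_set n)" using n by (intro finite_beta_set) auto
  show "b \<le> smarandache n" if "b \<in> beta_set n" for b
    using that n by (auto simp: beta_set_def intro!: smarandache_le
      intro: dvd_trans[OF gcd_dvd1 smarandache_dvd])
  have "least_prime_divisor n \<le> n" using least_prime_divisor_dvd n by (intro dvd_imp_le) auto
  moreover have "gcd n (fact n) = n" using n by (intro gcd_nat.absorb1) (simp add: dvd_fact)
  ultimately show "smarandache n \<in> beta_set n"
    using smarandache_gcd_fact_mem_beta_set[of n] by simp
qed

lemma Min_beta_set: "Min (beta_set n) = least_prime_divisor n"
proof (rule Min_eqI)
  let ?q = "least_prime_divisor n"
  show "finite (beta_set n)" using n by (intro finite_beta_set) auto
  show "?q \<le> b" if "b \<in> beta_set n" for b
    using that by (auto simp: beta_set_def)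
  have "smarandache (gcd n (fact ?q)) \<le> ?q" by (rule smarandache_le) simp
  moreover have "smarandache (gcd n (fact ?q)) \<in> beta_set n"
    by (rule smarandache_gcd_fact_mem_beta_set) simp
  ultimately show "?q \<in> beta_set n"
    by (smt (verit, best) beta_set_def mem_Collect_eq order_antisym)
qed

section \<open>Collecting equal factors\<close>

lemma beta_enumerates:
  shows beta_mem: "1 \<le> k \<Longrightarrow> k \<le> beta_count n \<Longrightarrow> beta n k \<in> beta_set n"
    and beta_less: "1 \<le> k \<Longrightarrow> k < l \<Longrightarrow> l \<le> beta_count n \<Longrightarrow> beta n l < beta n k"
    and beta_exists: "b \<in> beta_set n \<Longrightarrow> \<exists>k. 1 \<le> k \<and> k \<le> beta_count n \<and> b = beta n k"
proof -
  define xs where "xs = rev (sorted_list_of_set (beta_set n))"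
  have fin: "finite (beta_set n)" using n by (intro finite_beta_set) auto
  have len: "length xs = beta_count n" by (simp add: xs_def beta_count_def)
  have set: "set xs = beta_set n" by (simp add: xs_def fin)
  have sorted: "sorted_wrt (>) xs" by (simp add: xs_def sorted_wrt_rev)
  have beta: "beta n k = xs ! (k - 1)" if "1 \<le> k" for k
    using that by (simp add: beta_def xs_def)
  show "beta n k \<in> beta_set n" if "1 \<le> k" "k \<le> beta_count n"
    using that len set nth_mem[of "k - 1" xs] by (simp add: beta)
  show "beta n l < beta n k" if "1 \<le> k" "k < l" "l \<le> beta_count n"
    using that len sorted_wrt_nth_less[OF sorted, of "k - 1" "l - 1"] by (simp add: beta)
  show "\<exists>k. 1 \<le> k \<and> k \<le> beta_count n \<and> b = beta n k" if "b \<in> beta_set n"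
  proof -
    have "b \<in> set xs" using that set by simp
    then obtain i where "i < length xs" "b = xs ! i"
      by (auto simp: in_set_conv_nth)
    thus ?thesis using len by (intro exI[of _ "Suc i"]) (auto simp: beta)
  qed
qed

lemma beta_count_pos: "beta_count n \<ge> 1"
  using beta_exists[OF smarandache_gcd_fact_mem_beta_set[of "least_prime_divisor n"]] by auto

lemma beta_antimono: "1 \<le> k \<Longrightarrow> k \<le> l \<Longrightarrow> l \<le> beta_count n \<Longrightarrow> beta n l \<le> beta n k"
  using beta_less[of k l] by (cases "k = l") auto

lemma beta_first: "beta n 1 = smarandache n"
proof -
  have fin: "finite (beta_set n)" using n by (intro finite_beta_set) auto
  have "Max (beta_set n) = beta n 1"
    using fin beta_count_pos beta_mem[of 1] beta_exists beta_antimono[of 1]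
    by (intro Max_eqI) auto
  thus ?thesis by (simp add: Max_beta_set)
qed

lemma beta_last: "beta n (beta_count n) = least_prime_divisor n"
proof -
  have fin: "finite (beta_set n)" using n by (intro finite_beta_set) auto
  have "Min (beta_set n) = beta n (beta_count n)"
    using fin beta_count_pos beta_mem[of "beta_count n"] beta_exists beta_antimono
    by (intro Min_eqI) auto
  thus ?thesis by (simp add: Min_beta_set)
qed

text \<open>
  Each factor with \<open>k > 1\<close> has a negative exponent and extends the product in the denominator
  downwards from $\beta_{k-1}$ to $\beta_k$.
\<close>

lemma beta_product_partial:
  assumes "1 \<le> m" "m \<le> beta_count n"
  shows "(\<Prod>k = 1..m. real (gcd n (fact (beta n k))) powi (int (beta n k) - int (beta n (k - 1)))) =
    real n ^ smarandache n / (\<Prod>j = beta n m..<smarandache n. real (gcd n (fact j)))"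
  using assms
proof (induction m rule: dec_induct)
  case base
  have "gcd n (fact (smarandache n)) = n"
    using n by (intro gcd_nat.absorb1 smarandache_dvd) auto
  \<comment> \<open>The denominator is the empty product, and \<open>beta n 0 = 0\<close>.\<close>
  thus ?case by (simp add: beta_first[simplified] beta_def[of n 0])
next
  case (step m)
  let ?g = "\<lambda>j. real (gcd n (fact j))"
  let ?b = "beta n m" and ?b' = "beta n (Suc m)"
  have lt: "?b' < ?b" using beta_less[of m "Suc m"] step by simp
  have le: "?b \<le> smarandache n" using beta_antimono[of 1 m] step beta_first by simp
  have gap: "gcd n (fact j) = gcd n (fact ?b')" if "j \<in> {?b'..<?b}" for j
  proof (rule gcd_fact_between)
    show "?b' \<le> j" using that by simp
    have "least_prime_divisor n \<le> ?b'"
      using beta_antimono[of "Suc m" "beta_count n"] step by (simp add: beta_last)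
    thus "least_prime_divisor n \<le> j" using that by simp
    fix b' assume b': "b' \<in> beta_set n" "b' \<le> j"
    then obtain k where k: "1 \<le> k" "k \<le> beta_count n" "b' = beta n k"
      using beta_exists by blast
    have "\<not> k \<le> m" using beta_antimono[of k m] k b' that step by auto
    thus "b' \<le> ?b'" using beta_antimono[of "Suc m" k] k by simp
  qed
  have "(\<Prod>j = ?b'..<?b. ?g j) = (\<Prod>j = ?b'..<?b. ?g ?b')"
    by (intro prod.cong refl arg_cong[of _ _ real] gap)
  hence "(\<Prod>j = ?b'..<?b. ?g j) = ?g ?b' ^ (?b - ?b')"
    by simp
  moreover have "?g ?b' powi (int ?b' - int ?b) = inverse (?g ?b' ^ (?b - ?b'))"
    using lt by (simp add: power_int_def nat_diff_distrib' flip: power_inverse)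
  moreover have "(\<Prod>j = ?b'..<smarandache n. ?g j) =
      (\<Prod>j = ?b'..<?b. ?g j) * (\<Prod>j = ?b..<smarandache n. ?g j)"
    using lt le by (simp add: prod.atLeastLessThan_concat)
  moreover have "(\<Prod>k = 1..m. real (gcd n (fact (beta n k))) powi (int (beta n k) - int (beta n (k - 1)))) =
      real n ^ smarandache n / (\<Prod>j = ?b..<smarandache n. ?g j)"
    using step by simp
  ultimately show ?case
    by (simp add: divide_inverse)
qed

lemma beta_product:
  "(\<Prod>k = 1..beta_count n. real (gcd n (fact (beta n k))) powi (int (beta n k) - int (beta n (k - 1)))) =
    real (\<Prod>j<smarandache n. n div gcd n (fact j))"
proof -
  let ?g = "\<lambda>j. real (gcd n (fact j))"
  let ?q = "least_prime_divisor n" and ?s = "smarandache n"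
  have "?q \<le> ?s"
    using beta_antimono[of 1 "beta_count n"] beta_count_pos beta_first beta_last by simp
  hence "(\<Prod>j<?s. ?g j) = (\<Prod>j<?q. ?g j) * (\<Prod>j = ?q..<?s. ?g j)"
    by (simp add: lessThan_atLeast0 prod.atLeastLessThan_concat)
  also have "(\<Prod>j<?q. ?g j) = 1"
    using gcd_fact_eq_1 by simp
  finally have "(\<Prod>j = ?q..<?s. ?g j) = (\<Prod>j<?s. ?g j)" by simp
  moreover have "real (\<Prod>j<?s. n div gcd n (fact j)) = (\<Prod>j<?s. real n / ?g j)"
    by (simp add: real_of_nat_div)
  ultimately show ?thesis
    using beta_product_partial[of "beta_count n"] beta_count_pos
    by (simp add: beta_last prod_dividef)
qed

end

theorem corollary9:
  fixes n :: nat
  assumes "n \<ge> 2"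
  shows "real (num_polyfunctions n) =
    (\<Prod>k = 1..beta_count n.
      real (gcd n (fact (beta n k))) powi (int (beta n k) - int (beta n (k - 1))))"
proof -
  have "smarandache n \<le> n"
    using assms by (intro smarandache_le dvd_fact) auto
  hence "num_polyfunctions n = (\<Prod>j<smarandache n. n div gcd n (fact j))"
    using assms by (intro num_polyfunctions_eq_prod smarandache_dvd) auto
  thus ?thesis using beta_product[OF assms] by simp
qed

end
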